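(* Let $(R,\mathfrak m)$ be a local ring. If $M$ is a bounded complex of finitely generated $R$-modules, then $\mathbf{I}^{\mathrm{stab}}(M,1)\ne0$.
   Context: "Local" means commutative Noetherian local; complexes are indexed homologically. Every bounded below complex $M$ of finitely generated $R$-modules has a minimal free resolution $F\xrightarrow{\simeq}M$, unique up to isomorphism: $F$ is a bounded below complex of finitely generated free modules, quasi-isomorphic to $M$, with $d(F)\subseteq\mathfrak mF$. Let $\mathbf I^r_i(F)$ be the ideal generated by the $r\times r$ minors of $d_i:F_i\to F_{i-1}$, taken to be $0$ if $r>\operatorname{rank}F_i$ or $r>\operatorname{rank}F_{i-1}$, except that it is the unit ideal whenever $F_i=0$ or $F_{i-1}=0$. The stable ideal of $r\times r$ minors of $M$ is $\mathbf I^{\mathrm{stab}}(M,r)=\bigcap_{n}\sum_{i>n}\mathbf I^r_i(F)$, the intersection over all integers $n\ge\inf\{j:F_j\ne0\}$. *)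

theory Defs
  imports "HOL-Algebra.Algebra" "HOL-Combinatorics.Permutations"
begin

locale local_ring = cring R + noetherian_ring R for R (structure) and m +
  assumes max_ideal: "maximalideal m R"
    and max_ideal_unique: "maximalideal I R \<Longrightarrow> I = m"

definition gen_submodule ::
  "('a, 'r) ring_scheme \<Rightarrow> ('a, 'b, 'p) module_scheme \<Rightarrow> 'b set \<Rightarrow> 'b set" where
  "gen_submodule R M S = \<Inter>{N. submodule N R M \<and> S \<subseteq> N}"

definition fin_gen :: "('a, 'r) ring_scheme \<Rightarrow> ('a, 'b, 'p) module_scheme \<Rightarrow> bool" where
  "fin_gen R M \<longleftrightarrow> (\<exists>S \<subseteq> carrier M. finite S \<and> gen_submodule R M S = carrier M)"

definition ideal_smult ::
  "('a, 'r) ring_scheme \<Rightarrow> 'a set \<Rightarrow> ('a, 'b, 'p) module_scheme \<Rightarrow> 'b set" where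
  "ideal_smult R I M = gen_submodule R M {a \<odot>\<^bsub>M\<^esub> x | a x. a \<in> I \<and> x \<in> carrier M}"

definition mod_hom ::
  "('a, 'r) ring_scheme \<Rightarrow> ('a, 'b, 'p) module_scheme \<Rightarrow> ('a, 'c, 'q) module_scheme \<Rightarrow> ('b \<Rightarrow> 'c) set"
  where
  "mod_hom R M N = {f \<in> carrier M \<rightarrow> carrier N.
     (\<forall>x \<in> carrier M. \<forall>y \<in> carrier M. f (x \<oplus>\<^bsub>M\<^esub> y) = f x \<oplus>\<^bsub>N\<^esub> f y) \<and>
     (\<forall>a \<in> carrier R. \<forall>x \<in> carrier M. f (a \<odot>\<^bsub>M\<^esub> x) = a \<odot>\<^bsub>N\<^esub> f x)}"

definition lincomb :: "('a, 'b, 'p) module_scheme \<Rightarrow> 'b list \<Rightarrow> (nat \<Rightarrow> 'a) \<Rightarrow> 'b" where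
  "lincomb M bs c = (\<Oplus>\<^bsub>M\<^esub> i \<in> {..<length bs}. c i \<odot>\<^bsub>M\<^esub> (bs ! i))"

definition is_basis ::
  "('a, 'r) ring_scheme \<Rightarrow> ('a, 'b, 'p) module_scheme \<Rightarrow> 'b list \<Rightarrow> bool" where
  "is_basis R M bs \<longleftrightarrow> set bs \<subseteq> carrier M \<and>
     (\<forall>x \<in> carrier M. \<exists>!c. c \<in> {..<length bs} \<rightarrow>\<^sub>E carrier R \<and> x = lincomb M bs c)"

definition fin_free :: "('a, 'r) ring_scheme \<Rightarrow> ('a, 'b, 'p) module_scheme \<Rightarrow> bool" where
  "fin_free R M \<longleftrightarrow> (\<exists>bs. is_basis R M bs)"

definition some_basis :: "('a, 'r) ring_scheme \<Rightarrow> ('a, 'b, 'p) module_scheme \<Rightarrow> 'b list" where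
  "some_basis R M = (SOME bs. is_basis R M bs)"

definition coord ::
  "('a, 'r) ring_scheme \<Rightarrow> ('a, 'b, 'p) module_scheme \<Rightarrow> 'b list \<Rightarrow> 'b \<Rightarrow> nat \<Rightarrow> 'a" where
  "coord R M bs x = (THE c. c \<in> {..<length bs} \<rightarrow>\<^sub>E carrier R \<and> x = lincomb M bs c)"

definition matrix_of ::
  "('a, 'r) ring_scheme \<Rightarrow> ('a, 'c, 'q) module_scheme \<Rightarrow> 'b list \<Rightarrow> 'c list \<Rightarrow> ('b \<Rightarrow> 'c)
    \<Rightarrow> nat \<Rightarrow> nat \<Rightarrow> 'a" where
  "matrix_of R N bs cs f i j = coord R N cs (f (bs ! j)) i"

definition det_of :: "('a, 'r) ring_scheme \<Rightarrow> nat \<Rightarrow> (nat \<Rightarrow> nat \<Rightarrow> 'a) \<Rightarrow> 'a" where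
  "det_of R r A =
     (\<Oplus>\<^bsub>R\<^esub> \<pi> \<in> {\<pi>. \<pi> permutes {..<r}}.
        [(sign \<pi> :: int)] \<cdot>\<^bsub>R\<^esub> (\<Otimes>\<^bsub>R\<^esub> i \<in> {..<r}. A i (\<pi> i)))"

definition minors ::
  "('a, 'r) ring_scheme \<Rightarrow> nat \<Rightarrow> nat \<Rightarrow> (nat \<Rightarrow> nat \<Rightarrow> 'a) \<Rightarrow> nat \<Rightarrow> 'a set" where
  "minors R p n A r =
     {det_of R r (\<lambda>i j. A (\<rho> i) (\<gamma> j)) | \<rho> \<gamma>.
        strict_mono_on {..<r} \<rho> \<and> \<rho> ` {..<r} \<subseteq> {..<p} \<and>
        strict_mono_on {..<r} \<gamma> \<and> \<gamma> ` {..<r} \<subseteq> {..<n}}"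

text \<open>
  The minors are taken with respect to chosen bases; by the Cauchy-Binet formula the ideal does
  not depend on the choice. If \<open>r\<close> exceeds one of the ranks, and both modules are
  nonzero, there are no minors and the ideal is zero, as the convention demands.
\<close>

definition minors_ideal ::
  "('a, 'r) ring_scheme \<Rightarrow> ('a, 'b, 'p) module_scheme \<Rightarrow> ('a, 'c, 'q) module_scheme \<Rightarrow> ('b \<Rightarrow> 'c)
    \<Rightarrow> nat \<Rightarrow> 'a set" where
  "minors_ideal R M N f r =
     (if carrier M = {\<zero>\<^bsub>M\<^esub>} \<or> carrier N = {\<zero>\<^bsub>N\<^esub>} then carrier R
      else Idl\<^bsub>R\<^esub> (minors R (length (some_basis R N)) (length (some_basis R M))
             (matrix_of R N (some_basis R M) (some_basis R N) f) r))"

record ('a, 'b) cplx =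
  obj :: "int \<Rightarrow> ('a, 'b) module"
  diff :: "int \<Rightarrow> 'b \<Rightarrow> 'b"

locale chain_complex =
  fixes R :: "('a, 'r) ring_scheme" and M :: "('a, 'b) cplx"
  assumes obj_module: "module R (obj M i)"
    and diff_hom: "diff M i \<in> mod_hom R (obj M i) (obj M (i - 1))"
    and diff_diff: "x \<in> carrier (obj M i) \<Longrightarrow> diff M (i - 1) (diff M i x) = \<zero>\<^bsub>obj M (i - 1 - 1)\<^esub>"

definition cplx_support :: "('a, 'b) cplx \<Rightarrow> int set" where
  "cplx_support M = {i. carrier (obj M i) \<noteq> {\<zero>\<^bsub>obj M i\<^esub>}}"

definition bounded_below_cplx :: "('a, 'b) cplx \<Rightarrow> bool" where
  "bounded_below_cplx M \<longleftrightarrow> bdd_below (cplx_support M)"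

definition bounded_cplx :: "('a, 'b) cplx \<Rightarrow> bool" where
  "bounded_cplx M \<longleftrightarrow> bdd_below (cplx_support M) \<and> bdd_above (cplx_support M)"

definition cycles :: "('a, 'b) cplx \<Rightarrow> int \<Rightarrow> 'b set" where
  "cycles M i = {x \<in> carrier (obj M i). diff M i x = \<zero>\<^bsub>obj M (i - 1)\<^esub>}"

definition boundaries :: "('a, 'b) cplx \<Rightarrow> int \<Rightarrow> 'b set" where
  "boundaries M i = diff M (i + 1) ` carrier (obj M (i + 1))"

definition homology :: "('a, 'b) cplx \<Rightarrow> int \<Rightarrow> 'b set monoid" where
  "homology M i = (add_monoid (obj M i))\<lparr>carrier := cycles M i\<rparr> Mod boundaries M i"

definition chain_map ::
  "('a, 'r) ring_scheme \<Rightarrow> ('a, 'b) cplx \<Rightarrow> ('a, 'c) cplx \<Rightarrow> (int \<Rightarrow> 'b \<Rightarrow> 'c) \<Rightarrow> bool" where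
  "chain_map R F M \<phi> \<longleftrightarrow>
     (\<forall>i. \<phi> i \<in> mod_hom R (obj F i) (obj M i) \<and>
          (\<forall>x \<in> carrier (obj F i). \<phi> (i - 1) (diff F i x) = diff M i (\<phi> i x)))"

definition homology_map ::
  "('a, 'c) cplx \<Rightarrow> (int \<Rightarrow> 'b \<Rightarrow> 'c) \<Rightarrow> int \<Rightarrow> 'b set \<Rightarrow> 'c set" where
  "homology_map M \<phi> i C = (\<Union>x \<in> C. boundaries M i +>\<^bsub>obj M i\<^esub> \<phi> i x)"

text \<open>The map induced by a chain map is automatically \<open>R\<close>-linear, so it is an
  isomorphism of modules as soon as it is one of additive groups.\<close>

definition quasi_iso ::
  "('a, 'r) ring_scheme \<Rightarrow> ('a, 'b) cplx \<Rightarrow> ('a, 'c) cplx \<Rightarrow> (int \<Rightarrow> 'b \<Rightarrow> 'c) \<Rightarrow> bool" where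
  "quasi_iso R F M \<phi> \<longleftrightarrow> chain_map R F M \<phi> \<and>
     (\<forall>i. homology_map M \<phi> i \<in> iso (homology F i) (homology M i))"

definition minimal_free_resolution ::
  "('a, 'r) ring_scheme \<Rightarrow> 'a set \<Rightarrow> ('a, 'b) cplx \<Rightarrow> ('a, 'c) cplx \<Rightarrow> bool" where
  "minimal_free_resolution R m F M \<longleftrightarrow>
     chain_complex R F \<and> bounded_below_cplx F \<and> (\<forall>i. fin_free R (obj F i)) \<and>
     (\<exists>\<phi>. quasi_iso R F M \<phi>) \<and>
     (\<forall>i. diff F i ` carrier (obj F i) \<subseteq> ideal_smult R m (obj F (i - 1)))"

definition minors_ideal_at ::
  "('a, 'r) ring_scheme \<Rightarrow> ('a, 'b) cplx \<Rightarrow> nat \<Rightarrow> int \<Rightarrow> 'a set" where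
  "minors_ideal_at R F r i = minors_ideal R (obj F i) (obj F (i - 1)) (diff F i) r"

text \<open>
  The stable ideal of \<open>M\<close> is computed from a minimal free resolution \<open>F\<close> of
  \<open>M\<close>. The (possibly infinite) sum of ideals is the ideal generated by their union.
  If \<open>F\<close> is zero, its support is empty and the integer \<open>Inf {}\<close> is
  unspecified; every ideal of minors is then the unit ideal, hence so is the intersection, in
  agreement with the empty intersection given by \<open>inf = \<infinity>\<close>.
\<close>

definition stable_ideal :: "('a, 'r) ring_scheme \<Rightarrow> ('a, 'b) cplx \<Rightarrow> nat \<Rightarrow> 'a set" where
  "stable_ideal R F r =
     (\<Inter>n \<in> {Inf (cplx_support F)..}. Idl\<^bsub>R\<^esub> (\<Union>i \<in> {n<..}. minors_ideal_at R F r i))"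

end

theory Submission
  imports Defs
begin

text \<open>
  Let \<open>s \<noteq> 0\<close> have a prime annihilator \<open>p\<close>, and let \<open>F\<close> be exact in degrees
  \<open>\<ge> k\<close>. Gaussian elimination over the domain \<open>R / p\<close> gives \<open>u \<notin> p\<close>
  and a linear map \<open>h\<close> with \<open>u d = d h d\<close> modulo \<open>p\<close>, where \<open>d\<close> is the
  differential in degree \<open>k\<close>; hence \<open>w = s u\<close> is nonzero and
  \<open>w d = d (s h) d\<close>. Exactness and freeness extend \<open>s h\<close> to a homotopy
  \<open>w = d h' + h d\<close> on all \<open>F\<^sub>j\<close> with \<open>j \<ge> k\<close>, so that \<open>w\<close> lies in the ideal
  generated by the entries of \<open>d\<^sub>j\<close> and \<open>d\<^sub>j\<^sub>+\<^sub>1\<close> for every such \<open>j\<close>.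
\<close>

section \<open>Linear maps\<close>

lemma mod_homI:
  assumes "\<And>x. x \<in> carrier M \<Longrightarrow> f x \<in> carrier N"
    and "\<And>x y. x \<in> carrier M \<Longrightarrow> y \<in> carrier M \<Longrightarrow> f (x \<oplus>\<^bsub>M\<^esub> y) = f x \<oplus>\<^bsub>N\<^esub> f y"
    and "\<And>a x. a \<in> carrier R \<Longrightarrow> x \<in> carrier M \<Longrightarrow> f (a \<odot>\<^bsub>M\<^esub> x) = a \<odot>\<^bsub>N\<^esub> f x"
  shows "f \<in> mod_hom R M N"
  using assms by (auto simp: mod_hom_def)

lemma
  assumes "f \<in> mod_hom R M N" and "x \<in> carrier M"
  shows mod_hom_closed: "f x \<in> carrier N"
    and mod_hom_add: "y \<in> carrier M \<Longrightarrow> f (x \<oplus>\<^bsub>M\<^esub> y) = f x \<oplus>\<^bsub>N\<^esub> f y"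
    and mod_hom_smult: "a \<in> carrier R \<Longrightarrow> f (a \<odot>\<^bsub>M\<^esub> x) = a \<odot>\<^bsub>N\<^esub> f x"
  using assms by (auto simp: mod_hom_def)

lemma mod_hom_comp:
  assumes "f \<in> mod_hom R M N" and "g \<in> mod_hom R N P"
  shows "(\<lambda>x. g (f x)) \<in> mod_hom R M P"
  using assms by (auto simp: mod_hom_def Pi_iff)

lemma mod_hom_zero:
  assumes "module R M" "module R N" "f \<in> mod_hom R M N"
  shows "f \<zero>\<^bsub>M\<^esub> = \<zero>\<^bsub>N\<^esub>"
proof -
  interpret M: module R M by fact
  interpret N: module R N by fact
  have "f (\<zero>\<^bsub>R\<^esub> \<odot>\<^bsub>M\<^esub> \<zero>\<^bsub>M\<^esub>) = \<zero>\<^bsub>R\<^esub> \<odot>\<^bsub>N\<^esub> f \<zero>\<^bsub>M\<^esub>"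
    using assms(3) by (rule mod_hom_smult) auto
  then show ?thesis
    using mod_hom_closed[OF assms(3)] by simp
qed

lemma mod_hom_minus:
  assumes "module R M" "module R N" "f \<in> mod_hom R M N" "x \<in> carrier M" "y \<in> carrier M"
  shows "f (x \<ominus>\<^bsub>M\<^esub> y) = f x \<ominus>\<^bsub>N\<^esub> f y"
proof -
  interpret M: module R M by fact
  interpret N: module R N by fact
  have fy: "f y \<in> carrier N" using assms mod_hom_closed by metis
  have "\<ominus>\<^bsub>M\<^esub> y = (\<ominus>\<^bsub>R\<^esub> \<one>\<^bsub>R\<^esub>) \<odot>\<^bsub>M\<^esub> y" "\<ominus>\<^bsub>N\<^esub> f y = (\<ominus>\<^bsub>R\<^esub> \<one>\<^bsub>R\<^esub>) \<odot>\<^bsub>N\<^esub> f y"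
    using assms(5) fy by (simp_all add: M.smult_l_minus N.smult_l_minus)
  then have "f (\<ominus>\<^bsub>M\<^esub> y) = \<ominus>\<^bsub>N\<^esub> f y"
    using mod_hom_smult[OF assms(3,5), of "\<ominus>\<^bsub>R\<^esub> \<one>\<^bsub>R\<^esub>"] by simp
  then show ?thesis
    using mod_hom_add[OF assms(3,4), of "\<ominus>\<^bsub>M\<^esub> y"] assms(5)
    by (simp add: M.minus_eq N.minus_eq)
qed

lemma mod_hom_finsum:
  assumes "module R M" "module R N" "f \<in> mod_hom R M N" "finite A" "g \<in> A \<rightarrow> carrier M"
  shows "f (\<Oplus>\<^bsub>M\<^esub>i\<in>A. g i) = (\<Oplus>\<^bsub>N\<^esub>i\<in>A. f (g i))"
proof -
  interpret M: module R M by fact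
  interpret N: module R N by fact
  show ?thesis
    using assms(4,5)
  proof (induction A rule: finite_induct)
    case empty
    then show ?case using mod_hom_zero[OF assms(1-3)] by simp
  next
    case (insert a A)
    then have "(\<lambda>i. f (g i)) \<in> insert a A \<rightarrow> carrier N"
      using mod_hom_closed[OF assms(3)] by blast
    with insert show ?case
      by (simp add: mod_hom_add[OF assms(3)] Pi_iff)
  qed
qed

lemma mod_hom_smult_map:
  assumes "module R N" "f \<in> mod_hom R M N" "a \<in> carrier R"
  shows "(\<lambda>x. a \<odot>\<^bsub>N\<^esub> f x) \<in> mod_hom R M N"
proof -
  interpret N: module R N by fact
  show ?thesis
    using assms(2,3)
    by (intro mod_homI)
       (auto simp: mod_hom_closed mod_hom_add mod_hom_smult N.smult_r_distr N.m_comm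
          simp flip: N.smult_assoc1)
qed

lemma mod_hom_add_map:
  assumes "module R N" "f \<in> mod_hom R M N" "g \<in> mod_hom R M N"
  shows "(\<lambda>x. f x \<oplus>\<^bsub>N\<^esub> g x) \<in> mod_hom R M N"
proof -
  interpret N: module R N by fact
  show ?thesis
    using assms(2,3)
    by (intro mod_homI)
       (auto simp: mod_hom_closed mod_hom_add mod_hom_smult N.smult_r_distr N.M.a_ac)
qed

lemma mod_hom_minus_map:
  assumes "module R N" "f \<in> mod_hom R M N" "g \<in> mod_hom R M N"
  shows "(\<lambda>x. f x \<ominus>\<^bsub>N\<^esub> g x) \<in> mod_hom R M N"
proof -
  interpret N: module R N by fact
  show ?thesis
    using assms(2,3)
    by (intro mod_homI)
       (auto simp: mod_hom_closed mod_hom_add mod_hom_smult N.smult_r_distr N.smult_r_minus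
          N.M.minus_eq N.M.a_ac N.M.minus_add)
qed

lemma mod_hom_id:
  "(\<lambda>x. x) \<in> mod_hom R M M"
  by (simp add: mod_hom_def)

section \<open>Coordinates\<close>

text \<open>A finitely generated free module with one ordered basis fixed. The unique existence in
  \<open>is_basis\<close> turns the definite description behind \<open>coord\<close> into an honest
  coordinate function.\<close>

locale based_module = module R M for R (structure) and M (structure) +
  fixes bs
  assumes basis: "is_basis R M bs"
begin

lemma basis_closed: "i < length bs \<Longrightarrow> bs ! i \<in> carrier M"
  using basis by (auto simp: is_basis_def)

lemma coord_props:
  assumes "x \<in> carrier M"
  shows "coord R M bs x \<in> {..<length bs} \<rightarrow>\<^sub>E carrier R" "x = lincomb M bs (coord R M bs x)"
proof -
  have "\<exists>!c. c \<in> {..<length bs} \<rightarrow>\<^sub>E carrier R \<and> x = lincomb M bs c"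
    using basis assms by (auto simp: is_basis_def)
  from theI'[OF this] show "coord R M bs x \<in> {..<length bs} \<rightarrow>\<^sub>E carrier R" 
    "x = lincomb M bs (coord R M bs x)"
    by (auto simp: coord_def)
qed

lemma coord_closed: "x \<in> carrier M \<Longrightarrow> i < length bs \<Longrightarrow> coord R M bs x i \<in> carrier R"
  using coord_props(1) by auto

lemma expand:
  "x \<in> carrier M \<Longrightarrow> x = (\<Oplus>\<^bsub>M\<^esub>i\<in>{..<length bs}. coord R M bs x i \<odot>\<^bsub>M\<^esub> bs ! i)"
  using coord_props(2) by (simp add: lincomb_def)

lemma coord_unique:
  assumes "\<And>i. i < length bs \<Longrightarrow> c i \<in> carrier R" and "i < length bs"
    and "x = (\<Oplus>\<^bsub>M\<^esub>i\<in>{..<length bs}. c i \<odot>\<^bsub>M\<^esub> bs ! i)"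
  shows "coord R M bs x i = c i"
proof -
  have x: "x \<in> carrier M"
    using assms by (auto intro!: M.finsum_closed basis_closed)
  \<comment> \<open>\<open>is_basis\<close> gives uniqueness only among extensional functions, so
    \<open>c\<close> is first made undefined outside the index range.\<close>
  let ?c = "restrict c {..<length bs}"
  have "x = lincomb M bs ?c"
    unfolding assms(3) lincomb_def using assms(1)
    by (intro M.finsum_cong') (auto simp: basis_closed)
  moreover have "?c \<in> {..<length bs} \<rightarrow>\<^sub>E carrier R" using assms(1) by auto
  moreover have "\<exists>!c. c \<in> {..<length bs} \<rightarrow>\<^sub>E carrier R \<and> x = lincomb M bs c"
    using basis x by (auto simp: is_basis_def)
  ultimately have "coord R M bs x = ?c" using coord_props[OF x] by blast
  then show ?thesis using assms(2) by simp
qed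

section \<open>Linearity of coordinates\<close>

lemma coord_add:
  assumes "x \<in> carrier M" "y \<in> carrier M" "i < length bs"
  shows "coord R M bs (x \<oplus>\<^bsub>M\<^esub> y) i = coord R M bs x i \<oplus> coord R M bs y i"
proof (rule coord_unique)
  have "x \<oplus>\<^bsub>M\<^esub> y = (\<Oplus>\<^bsub>M\<^esub>i\<in>{..<length bs}. coord R M bs x i \<odot>\<^bsub>M\<^esub> bs ! i)
      \<oplus>\<^bsub>M\<^esub> (\<Oplus>\<^bsub>M\<^esub>i\<in>{..<length bs}. coord R M bs y i \<odot>\<^bsub>M\<^esub> bs ! i)"
    using expand assms(1,2) by simp
  also have "\<dots> = (\<Oplus>\<^bsub>M\<^esub>i\<in>{..<length bs}.
      coord R M bs x i \<odot>\<^bsub>M\<^esub> bs ! i \<oplus>\<^bsub>M\<^esub> coord R M bs y i \<odot>\<^bsub>M\<^esub> bs ! i)"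
    by (intro M.finsum_addf[symmetric]) (auto simp: coord_closed basis_closed assms)
  also have "\<dots> = (\<Oplus>\<^bsub>M\<^esub>i\<in>{..<length bs}.
      (coord R M bs x i \<oplus> coord R M bs y i) \<odot>\<^bsub>M\<^esub> bs ! i)"
    by (intro M.finsum_cong') (auto simp: coord_closed basis_closed assms smult_l_distr)
  finally show "x \<oplus>\<^bsub>M\<^esub> y = \<dots>" .
qed (use assms coord_closed in auto)

lemma coord_smult:
  assumes "a \<in> carrier R" "x \<in> carrier M" "i < length bs"
  shows "coord R M bs (a \<odot>\<^bsub>M\<^esub> x) i = a \<otimes> coord R M bs x i"
proof (rule coord_unique)
  have "a \<odot>\<^bsub>M\<^esub> x = a \<odot>\<^bsub>M\<^esub> (\<Oplus>\<^bsub>M\<^esub>i\<in>{..<length bs}. coord R M bs x i \<odot>\<^bsub>M\<^esub> bs ! i)"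
    using expand assms(2) by simp
  also have "\<dots> = (\<Oplus>\<^bsub>M\<^esub>i\<in>{..<length bs}. a \<odot>\<^bsub>M\<^esub> (coord R M bs x i \<odot>\<^bsub>M\<^esub> bs ! i))"
    by (intro finsum_smult_ldistr) (auto simp: coord_closed basis_closed assms)
  also have "\<dots> = (\<Oplus>\<^bsub>M\<^esub>i\<in>{..<length bs}. (a \<otimes> coord R M bs x i) \<odot>\<^bsub>M\<^esub> bs ! i)"
    by (intro M.finsum_cong') (auto simp: coord_closed basis_closed assms smult_assoc1)
  finally show "a \<odot>\<^bsub>M\<^esub> x = \<dots>" .
qed (use assms coord_closed in auto)

lemma coord_zero:
  assumes "i < length bs"
  shows "coord R M bs \<zero>\<^bsub>M\<^esub> i = \<zero>"
  using coord_smult[of \<zero> "\<zero>\<^bsub>M\<^esub>" i] assms by (simp add: coord_closed)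

lemma coord_finsum:
  assumes "finite A" "g \<in> A \<rightarrow> carrier M" "i < length bs"
  shows "coord R M bs (\<Oplus>\<^bsub>M\<^esub>j\<in>A. g j) i = (\<Oplus>j\<in>A. coord R M bs (g j) i)"
  using assms
proof (induction A rule: finite_induct)
  case (insert a A)
  then show ?case by (simp add: coord_add coord_closed Pi_iff)
qed (simp add: coord_zero)

lemma coord_basis:
  assumes "i < length bs" "j < length bs"
  shows "coord R M bs (bs ! i) j = (if i = j then \<one> else \<zero>)"
proof (rule coord_unique)
  have "(\<Oplus>\<^bsub>M\<^esub>k\<in>{..<length bs}. (if i = k then \<one> else \<zero>) \<odot>\<^bsub>M\<^esub> bs ! k)
      = (\<Oplus>\<^bsub>M\<^esub>k\<in>{..<length bs}. if i = k then bs ! k else \<zero>\<^bsub>M\<^esub>)"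
    by (intro M.finsum_cong') (auto simp: basis_closed)
  also have "\<dots> = bs ! i"
    using assms by (intro M.finsum_singleton) (auto simp: basis_closed)
  finally show "bs ! i = (\<Oplus>\<^bsub>M\<^esub>k\<in>{..<length bs}. (if i = k then \<one> else \<zero>) \<odot>\<^bsub>M\<^esub> bs ! k)"
    by simp
qed (use assms in auto)

text \<open>With an empty basis every expansion is an empty sum. The lemma provides the vector
  \<open>bs ! 0\<close>, at which a diagonal entry can be read off.\<close>

lemma length_pos:
  assumes "carrier M \<noteq> {\<zero>\<^bsub>M\<^esub>}"
  shows "0 < length bs"
proof (rule ccontr)
  assume "\<not> 0 < length bs"
  then have "x = \<zero>\<^bsub>M\<^esub>" if "x \<in> carrier M" for x
    using expand[OF that] by simp
  then show False using assms by auto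
qed

section \<open>Linear maps out of a free module\<close>

lemma hom_expand:
  assumes "module R N" "f \<in> mod_hom R M N" "x \<in> carrier M"
  shows "f x = (\<Oplus>\<^bsub>N\<^esub>i\<in>{..<length bs}. coord R M bs x i \<odot>\<^bsub>N\<^esub> f (bs ! i))"
proof -
  interpret N: module R N by fact
  have "f x = f (\<Oplus>\<^bsub>M\<^esub>i\<in>{..<length bs}. coord R M bs x i \<odot>\<^bsub>M\<^esub> bs ! i)"
    using expand assms(3) by simp
  also have "\<dots> = (\<Oplus>\<^bsub>N\<^esub>i\<in>{..<length bs}. f (coord R M bs x i \<odot>\<^bsub>M\<^esub> bs ! i))"
    by (intro mod_hom_finsum[OF module_axioms assms(1,2)])
       (auto simp: coord_closed basis_closed assms)
  also have "\<dots> = (\<Oplus>\<^bsub>N\<^esub>i\<in>{..<length bs}. coord R M bs x i \<odot>\<^bsub>N\<^esub> f (bs ! i))"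
    using assms by (intro N.finsum_cong')
       (auto simp: coord_closed basis_closed mod_hom_smult mod_hom_closed)
  finally show ?thesis .
qed

lemma hom_eqI:
  assumes "module R N" "f \<in> mod_hom R M N" "g \<in> mod_hom R M N"
    and "\<And>i. i < length bs \<Longrightarrow> f (bs ! i) = g (bs ! i)" and "x \<in> carrier M"
  shows "f x = g x"
proof -
  interpret N: module R N by fact
  show ?thesis
    unfolding hom_expand[OF assms(1,2,5)] hom_expand[OF assms(1,3,5)]
    using assms by (intro N.finsum_cong') (auto simp: coord_closed basis_closed mod_hom_closed)
qed

text \<open>The universal property of a free module: coordinates are linear, so weighting the
  prescribed values by them gives a linear map, and \<open>coord_basis\<close> evaluates it on the
  basis.\<close>

lemma hom_extend:
  assumes "module R N" and y: "\<And>i. i < length bs \<Longrightarrow> y i \<in> carrier N"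
  obtains h where "h \<in> mod_hom R M N" "\<And>i. i < length bs \<Longrightarrow> h (bs ! i) = y i"
proof -
  interpret N: module R N by fact
  define h where "h x = (\<Oplus>\<^bsub>N\<^esub>i\<in>{..<length bs}. coord R M bs x i \<odot>\<^bsub>N\<^esub> y i)" for x
  have h: "h \<in> mod_hom R M N"
  proof (rule mod_homI)
    fix x x' assume x: "x \<in> carrier M" "x' \<in> carrier M"
    have "h (x \<oplus>\<^bsub>M\<^esub> x') = (\<Oplus>\<^bsub>N\<^esub>i\<in>{..<length bs}.
        coord R M bs x i \<odot>\<^bsub>N\<^esub> y i \<oplus>\<^bsub>N\<^esub> coord R M bs x' i \<odot>\<^bsub>N\<^esub> y i)"
      unfolding h_def using x
      by (intro N.finsum_cong') (auto simp: coord_add coord_closed y N.smult_l_distr)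
    also have "\<dots> = h x \<oplus>\<^bsub>N\<^esub> h x'"
      unfolding h_def using x by (intro N.finsum_addf) (auto simp: coord_closed y)
    finally show "h (x \<oplus>\<^bsub>M\<^esub> x') = h x \<oplus>\<^bsub>N\<^esub> h x'" .
  next
    fix a x assume x: "a \<in> carrier R" "x \<in> carrier M"
    have "h (a \<odot>\<^bsub>M\<^esub> x) = (\<Oplus>\<^bsub>N\<^esub>i\<in>{..<length bs}. a \<odot>\<^bsub>N\<^esub> (coord R M bs x i \<odot>\<^bsub>N\<^esub> y i))"
      unfolding h_def using x
      by (intro N.finsum_cong') (auto simp: coord_smult coord_closed y N.smult_assoc1)
    also have "\<dots> = a \<odot>\<^bsub>N\<^esub> h x"
      unfolding h_def using x
      by (intro N.finsum_smult_ldistr[symmetric]) (auto simp: coord_closed y)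
    finally show "h (a \<odot>\<^bsub>M\<^esub> x) = a \<odot>\<^bsub>N\<^esub> h x" .
  qed (auto simp: h_def coord_closed y intro!: N.finsum_closed)
  have "h (bs ! i) = y i" if i: "i < length bs" for i
  proof -
    have "h (bs ! i) = (\<Oplus>\<^bsub>N\<^esub>j\<in>{..<length bs}. if i = j then y j else \<zero>\<^bsub>N\<^esub>)"
      unfolding h_def using i
      by (intro N.finsum_cong') (auto simp: coord_basis y)
    also have "\<dots> = y i"
      using i by (intro N.finsum_singleton) (auto simp: y)
    finally show ?thesis .
  qed
  with h that show ?thesis by blast
qed

text \<open>Free modules are projective: choose preimages of the images of the basis vectors and
  extend linearly.\<close>

lemma hom_lift:
  assumes "module R N" "module R P" "f \<in> mod_hom R M N" "g \<in> mod_hom R P N"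
    and "\<And>x. x \<in> carrier M \<Longrightarrow> f x \<in> g ` carrier P"
  obtains h where "h \<in> mod_hom R M P" "\<And>x. x \<in> carrier M \<Longrightarrow> g (h x) = f x"
proof -
  have "\<forall>i<length bs. \<exists>y\<in>carrier P. g y = f (bs ! i)"
    using assms(5) basis_closed by (metis image_iff)
  then obtain y where y: "\<And>i. i < length bs \<Longrightarrow> y i \<in> carrier P \<and> g (y i) = f (bs ! i)"
    by metis
  obtain h where h: "h \<in> mod_hom R M P" "\<And>i. i < length bs \<Longrightarrow> h (bs ! i) = y i"
    using hom_extend[OF assms(2), of y] y by blast
  have "g (h x) = f x" if "x \<in> carrier M" for x
    using hom_eqI[OF assms(1) mod_hom_comp[OF h(1) assms(4)] assms(3) _ that] h(2) y by simp
  with h(1) that show ?thesis by blast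
qed

end


section \<open>Inverting a linear map up to a scalar\<close>

lemma (in cring) annihilator_ideal:
  assumes "t \<in> carrier R"
  shows "ideal {x \<in> carrier R. t \<otimes> x = \<zero>} R"
proof (rule idealI[OF ring_axioms])
  show "subgroup {x \<in> carrier R. t \<otimes> x = \<zero>} (add_monoid R)"
    using assms
    by (intro subgroup.intro) (auto simp: r_distr r_minus simp flip: a_inv_def)
next
  fix a x assume ax: "a \<in> {x \<in> carrier R. t \<otimes> x = \<zero>}" "x \<in> carrier R"
  then have "t \<otimes> (x \<otimes> a) = x \<otimes> (t \<otimes> a)" by (intro m_lcomm[OF assms]) auto
  then show "x \<otimes> a \<in> {x \<in> carrier R. t \<otimes> x = \<zero>}" using ax assms by simp
  then show "a \<otimes> x \<in> {x \<in> carrier R. t \<otimes> x = \<zero>}" using ax by (simp add: m_comm)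
qed

text \<open>A maximal annihilator of a nonzero element is prime: if \<open>s a\<close> is nonzero,
  its annihilator contains that of \<open>s\<close>, hence equals it, so \<open>s a b = 0\<close>
  forces \<open>s b = 0\<close>. Primality is phrased through products with \<open>s\<close>, so
  that the quotient ring need not be formed.\<close>

lemma (in cring) exists_prime_annihilator:
  assumes "noetherian_ring R" "\<one> \<noteq> \<zero>"
  obtains s where "s \<in> carrier R" "s \<noteq> \<zero>"
    "\<And>a b. a \<in> carrier R \<Longrightarrow> b \<in> carrier R \<Longrightarrow> s \<otimes> a \<noteq> \<zero> \<Longrightarrow> s \<otimes> b \<noteq> \<zero>
      \<Longrightarrow> s \<otimes> (a \<otimes> b) \<noteq> \<zero>"
proof -
  interpret noetherian_ring R by fact
  define ann where "ann t = {x \<in> carrier R. t \<otimes> x = \<zero>}" for t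
  define A where "A = ann ` (carrier R - {\<zero>})"
  \<comment> \<open>Zorn's lemma applies because in a Noetherian ring the union of a nonempty chain
    of ideals is a member of the chain.\<close>
  have "\<exists>P\<in>A. \<forall>I\<in>A. P \<subseteq> I \<longrightarrow> I = P"
  proof (rule subset_Zorn_nonempty)
    show "A \<noteq> {}" using assms(2) by (auto simp: A_def)
    fix C assume C: "C \<noteq> {}" "subset.chain A C"
    then have "subset.chain {I. ideal I R} C"
      using annihilator_ideal unfolding pred_on.chain_def A_def ann_def by blast
    from ideal_chain_is_trivial[OF C(1) this] C(2) show "\<Union> C \<in> A"
      unfolding pred_on.chain_def by blast
  qed
  then obtain s where s: "s \<in> carrier R" "s \<noteq> \<zero>" and
    max: "\<And>t. t \<in> carrier R \<Longrightarrow> t \<noteq> \<zero> \<Longrightarrow> ann s \<subseteq> ann t \<Longrightarrow> ann t = ann s"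
    unfolding A_def by blast
  have "s \<otimes> (a \<otimes> b) \<noteq> \<zero>"
    if ab: "a \<in> carrier R" "b \<in> carrier R" "s \<otimes> a \<noteq> \<zero>" "s \<otimes> b \<noteq> \<zero>" for a b
  proof
    assume 0: "s \<otimes> (a \<otimes> b) = \<zero>"
    have "ann s \<subseteq> ann (s \<otimes> a)"
    proof
      fix x assume "x \<in> ann s"
      then have x: "x \<in> carrier R" "s \<otimes> x = \<zero>" by (auto simp: ann_def)
      have "s \<otimes> a \<otimes> x = a \<otimes> (s \<otimes> x)" using s ab x(1) by algebra
      then show "x \<in> ann (s \<otimes> a)" using x ab by (simp add: ann_def)
    qed
    then have "ann (s \<otimes> a) = ann s" using max s ab by simp
    moreover have "b \<in> ann (s \<otimes> a)" using 0 s ab by (simp add: ann_def m_assoc)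
    ultimately show False using ab by (auto simp: ann_def)
  qed
  with s that show ?thesis by blast
qed

text \<open>Supplies the pivot of the elimination: if \<open>s\<close> killed every coordinate of
  \<open>y\<close>, the expansion of \<open>s y\<close> would be zero.\<close>

lemma (in based_module) exists_coord_nonzero:
  assumes "s \<in> carrier R" "y \<in> carrier M" "s \<odot>\<^bsub>M\<^esub> y \<noteq> \<zero>\<^bsub>M\<^esub>"
  obtains k where "k < length bs" "s \<otimes> coord R M bs y k \<noteq> \<zero>"
proof -
  have "\<exists>k<length bs. s \<otimes> coord R M bs y k \<noteq> \<zero>"
  proof (rule ccontr)
    assume neg: "\<not> ?thesis"
    have "s \<odot>\<^bsub>M\<^esub> y = (\<Oplus>\<^bsub>M\<^esub>i\<in>{..<length bs}. coord R M bs (s \<odot>\<^bsub>M\<^esub> y) i \<odot>\<^bsub>M\<^esub> bs ! i)"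
      using assms by (intro expand) auto
    also have "\<dots> = (\<Oplus>\<^bsub>M\<^esub>i\<in>{..<length bs}. \<zero>\<^bsub>M\<^esub>)"
      using neg assms by (intro M.finsum_cong') (auto simp: coord_smult basis_closed)
    finally show False using assms by simp
  qed
  with that show ?thesis by blast
qed

text \<open>
  Gaussian elimination over the domain \<open>R / ann s\<close>: a pivot \<open>a\<close> in column \<open>l\<close>
  is used to pass from \<open>d\<close> to \<open>(a - d E) d\<close>, which kills the column \<open>l\<close>.
\<close>

lemma scaled_inverse:
  fixes R (structure)
  assumes "based_module R M bs" "based_module R N cs" "d \<in> mod_hom R M N"
    and s: "s \<in> carrier R" "s \<noteq> \<zero>"
    and prime: "\<And>a b. a \<in> carrier R \<Longrightarrow> b \<in> carrier R \<Longrightarrow> s \<otimes> a \<noteq> \<zero> \<Longrightarrow> s \<otimes> b \<noteq> \<zero>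
      \<Longrightarrow> s \<otimes> (a \<otimes> b) \<noteq> \<zero>"
  shows "\<exists>u\<in>carrier R. s \<otimes> u \<noteq> \<zero> \<and>
    (\<exists>h\<in>mod_hom R N M. \<forall>x\<in>carrier M. (s \<otimes> u) \<odot>\<^bsub>N\<^esub> d x = s \<odot>\<^bsub>N\<^esub> d (h (d x)))"
proof -
  interpret M: based_module R M bs by fact
  interpret N: based_module R N cs by fact
  have mM: "module R M" and mN: "module R N" by unfold_locales
  show ?thesis
    using assms(3)
  \<comment> \<open>The induction runs on the number of columns of \<open>d\<close> that are nonzero
    modulo the annihilator of \<open>s\<close>.\<close>
  proof (induction "card {j. j < length bs \<and> s \<odot>\<^bsub>N\<^esub> d (bs ! j) \<noteq> \<zero>\<^bsub>N\<^esub>}"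
      arbitrary: d rule: less_induct)
    case less
    note d = less.prems
    note dc = mod_hom_closed[OF d]
    show ?case
    proof (cases "\<forall>j<length bs. s \<odot>\<^bsub>N\<^esub> d (bs ! j) = \<zero>\<^bsub>N\<^esub>")
      case True
      \<comment> \<open>No column is left, so \<open>s d = 0\<close>, and \<open>u = 1\<close>,
        \<open>h = 0\<close> serve as witnesses.\<close>
      have zero: "(\<lambda>x. \<zero>\<^bsub>N\<^esub>) \<in> mod_hom R M N" "(\<lambda>x. \<zero>\<^bsub>M\<^esub>) \<in> mod_hom R N M"
        by (auto intro: mod_homI)
      have "s \<odot>\<^bsub>N\<^esub> d x = \<zero>\<^bsub>N\<^esub>" if "x \<in> carrier M" for x
        using True by (intro M.hom_eqI[OF mN mod_hom_smult_map[OF mN d s(1)] zero(1) _ that]) auto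
      then have "\<forall>x\<in>carrier M. (s \<otimes> \<one>) \<odot>\<^bsub>N\<^esub> d x = s \<odot>\<^bsub>N\<^esub> d \<zero>\<^bsub>M\<^esub>"
        using s mod_hom_zero[OF mM mN d] by simp
      moreover have "s \<otimes> \<one> \<noteq> \<zero>" using s by simp
      ultimately show ?thesis using zero(2) M.R.one_closed by (intro bexI conjI) 
    next
      case False
      then obtain l where l: "l < length bs" "s \<odot>\<^bsub>N\<^esub> d (bs ! l) \<noteq> \<zero>\<^bsub>N\<^esub>" by blast
      have bl: "bs ! l \<in> carrier M" using l(1) by (rule M.basis_closed)
      obtain k where k: "k < length cs" "s \<otimes> coord R N cs (d (bs ! l)) k \<noteq> \<zero>"
        using N.exists_coord_nonzero[OF s(1) dc[OF bl] l(2)] .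
      define a where "a = coord R N cs (d (bs ! l)) k"
      have a: "a \<in> carrier R" "s \<otimes> a \<noteq> \<zero>"
        using k N.coord_closed[OF dc[OF bl]] by (auto simp: a_def)
      \<comment> \<open>\<open>E\<close> is chosen so that \<open>E (d b) = a b\<close> for the
        basis vector \<open>b\<close> of column \<open>l\<close>; this is why \<open>a - d E\<close>
        kills that column of \<open>d\<close>.\<close>
      define E where "E y = coord R N cs y k \<odot>\<^bsub>M\<^esub> bs ! l" for y
      have E: "E \<in> mod_hom R N M"
        using k(1) bl unfolding E_def
        by (intro mod_homI)
           (auto simp: N.coord_closed N.coord_add N.coord_smult M.smult_l_distr M.smult_assoc1)
      note Ec = mod_hom_closed[OF E]
      \<comment> \<open>\<open>q = a - E d\<close> and \<open>r = a - d E\<close> are intertwined by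
        \<open>d\<close>, that is \<open>r d = d q\<close>; this later moves \<open>r\<close> from
        the target to the source.\<close>
      define q where "q x = a \<odot>\<^bsub>M\<^esub> x \<ominus>\<^bsub>M\<^esub> E (d x)" for x
      define r where "r y = a \<odot>\<^bsub>N\<^esub> y \<ominus>\<^bsub>N\<^esub> d (E y)" for y
      have q: "q \<in> mod_hom R M M"
        unfolding q_def
        by (intro mod_hom_minus_map[OF mM] mod_hom_smult_map[OF mM mod_hom_id a(1)]
            mod_hom_comp[OF d E])
      have r: "r \<in> mod_hom R N N"
        unfolding r_def
        by (intro mod_hom_minus_map[OF mN] mod_hom_smult_map[OF mN mod_hom_id a(1)]
            mod_hom_comp[OF E d])
      note qc = mod_hom_closed[OF q] and rc = mod_hom_closed[OF r]
      have rd: "r (d x) = d (q x)" if x: "x \<in> carrier M" for x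
        using x a(1) Ec dc unfolding q_def r_def
        by (simp add: mod_hom_minus[OF mM mN d] mod_hom_smult[OF d])
      have rdl: "r (d (bs ! l)) = \<zero>\<^bsub>N\<^esub>"
        using a(1) bl dc unfolding r_def
        by (simp add: E_def mod_hom_smult[OF d] flip: a_def)
           (simp add: N.M.minus_eq N.M.r_neg)
      \<comment> \<open>Since \<open>r\<close> is linear, a column killed by \<open>s\<close> stays
        killed after composing with \<open>r\<close>; column \<open>l\<close> is killed in addition,
        so the count drops.\<close>
      let ?S = "\<lambda>d. {j. j < length bs \<and> s \<odot>\<^bsub>N\<^esub> d (bs ! j) \<noteq> \<zero>\<^bsub>N\<^esub>}"
      have "j \<in> ?S d" if "j \<in> ?S (\<lambda>x. r (d x))" for j
      proof -
        have bj: "bs ! j \<in> carrier M" using that M.basis_closed by auto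
        have "s \<odot>\<^bsub>N\<^esub> r (d (bs ! j)) = r (s \<odot>\<^bsub>N\<^esub> d (bs ! j))"
          using s(1) bj dc by (simp add: mod_hom_smult[OF r])
        with that show ?thesis using mod_hom_zero[OF mN mN r] by auto
      qed
      moreover have "l \<in> ?S d" "l \<notin> ?S (\<lambda>x. r (d x))" using l rdl s by auto
      ultimately have "?S (\<lambda>x. r (d x)) \<subset> ?S d" by blast
      then have "card (?S (\<lambda>x. r (d x))) < card (?S d)" by (intro psubset_card_mono) auto
      from less.hyps[OF this mod_hom_comp[OF d r]]
      obtain u h where u: "u \<in> carrier R" "s \<otimes> u \<noteq> \<zero>" and h: "h \<in> mod_hom R N M"
        and uh: "\<And>x. x \<in> carrier M \<Longrightarrow>
          (s \<otimes> u) \<odot>\<^bsub>N\<^esub> r (d x) = s \<odot>\<^bsub>N\<^esub> r (d (h (r (d x))))"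
        by blast
      note hc = mod_hom_closed[OF h]
      \<comment> \<open>Write \<open>a d = r d + d E d\<close>. Multiplied by \<open>s u\<close>,
        the first term becomes \<open>s r d h r d = s d q h r d\<close> by induction and
        intertwining, the second \<open>s d (u E) d\<close>. Hence the new scalar is
        \<open>u a\<close> and the new map \<open>q h r + u E\<close>.\<close>
      define h' where "h' y = q (h (r y)) \<oplus>\<^bsub>M\<^esub> u \<odot>\<^bsub>M\<^esub> E y" for y
      have h': "h' \<in> mod_hom R N M"
        unfolding h'_def
        by (intro mod_hom_add_map[OF mM] mod_hom_smult_map[OF mM E u(1)]
            mod_hom_comp[OF mod_hom_comp[OF r h] q])
      have "(s \<otimes> (u \<otimes> a)) \<odot>\<^bsub>N\<^esub> d x = s \<odot>\<^bsub>N\<^esub> d (h' (d x))" if x: "x \<in> carrier M" for x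
      proof -
        note [simp] = x dc Ec qc rc hc s(1) u(1) a(1)
        have "a \<odot>\<^bsub>N\<^esub> d x = r (d x) \<oplus>\<^bsub>N\<^esub> d (E (d x))"
          by (simp add: r_def N.M.minus_eq N.M.a_assoc N.M.l_neg)
        then have "(s \<otimes> u) \<odot>\<^bsub>N\<^esub> (a \<odot>\<^bsub>N\<^esub> d x)
            = (s \<otimes> u) \<odot>\<^bsub>N\<^esub> r (d x) \<oplus>\<^bsub>N\<^esub> (s \<otimes> u) \<odot>\<^bsub>N\<^esub> d (E (d x))"
          by (simp add: N.smult_r_distr)
        also have "\<dots> = s \<odot>\<^bsub>N\<^esub> d (q (h (r (d x)))) \<oplus>\<^bsub>N\<^esub> s \<odot>\<^bsub>N\<^esub> d (u \<odot>\<^bsub>M\<^esub> E (d x))"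
          using uh[OF x] rd[of "h (r (d x))"]
          by (simp add: mod_hom_smult[OF d] N.smult_assoc1)
        also have "\<dots> = s \<odot>\<^bsub>N\<^esub> d (h' (d x))"
          by (simp add: h'_def mod_hom_add[OF d] N.smult_r_distr)
        finally show ?thesis
          by (simp add: N.smult_assoc1)
      qed
      \<comment> \<open>Primality keeps the product of the pivots outside the annihilator.\<close>
      moreover have "s \<otimes> (u \<otimes> a) \<noteq> \<zero>" using prime u a by blast
      ultimately show ?thesis using h' u a by blast
    qed
  qed
qed

section \<open>Ideals of entries\<close>

text \<open>Only the identity permutes a one-element set, so a determinant of size 1 is its entry;
  constant index maps are vacuously strictly increasing there.\<close>

lemma (in cring) entry_in_minors:
  assumes "i < p" "j < n" "A i j \<in> carrier R"
  shows "A i j \<in> minors R p n A 1"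
proof -
  have "{\<pi>. \<pi> permutes {..<Suc 0}} = {id}" by (auto simp: lessThan_Suc)
  then have "A i j = det_of R 1 (\<lambda>_ _. A i j)"
    using assms(3) by (simp add: det_of_def lessThan_Suc add_pow_int_ge)
  moreover have "strict_mono_on {..<1} (\<lambda>_::nat. i)" "strict_mono_on {..<1} (\<lambda>_::nat. j)"
    by (auto simp: strict_mono_on_def)
  ultimately show ?thesis
    unfolding minors_def using assms(1,2) 
    by (intro CollectI exI[of _ "\<lambda>_. i"] exI[of _ "\<lambda>_. j"] conjI) auto
qed

lemma (in ideal) finsum_mult_mem:
  assumes "cring R" "finite A" "g \<in> A \<rightarrow> carrier R" "f \<in> A \<rightarrow> I"
  shows "(\<Oplus>i\<in>A. f i \<otimes> g i) \<in> I" "(\<Oplus>i\<in>A. g i \<otimes> f i) \<in> I"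
proof -
  have "(\<Oplus>i\<in>A. h i) \<in> I" if "h \<in> A \<rightarrow> I" for h
    using assms(2) that
  proof (induction A rule: finite_induct)
    case (insert a A)
    then have "h a \<in> I" and IH: "(\<Oplus>i\<in>A. h i) \<in> I" by blast+
    moreover have "h a \<in> carrier R" "h \<in> A \<rightarrow> carrier R" using insert.prems a_subset by blast+
    then have "(\<Oplus>i\<in>insert a A. h i) = h a \<oplus> (\<Oplus>i\<in>A. h i)"
      using insert.hyps by (intro finsum_insert)
    ultimately show ?case by simp
  qed simp
  from this[of "\<lambda>i. f i \<otimes> g i"] this[of "\<lambda>i. g i \<otimes> f i"]
  show "(\<Oplus>i\<in>A. f i \<otimes> g i) \<in> I" "(\<Oplus>i\<in>A. g i \<otimes> f i) \<in> I"
    using assms I_l_closed I_r_closed by (simp_all add: Pi_iff)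
qed

text \<open>The matrix-vector product. It puts a coordinate of \<open>f x\<close> into an ideal once
  all coordinates of \<open>x\<close>, or all entries in the relevant row of \<open>f\<close>, lie
  there.\<close>

lemma coord_hom_expand:
  assumes "based_module R M bs" "based_module R N cs" "f \<in> mod_hom R M N"
    and "x \<in> carrier M" "i < length cs"
  shows "coord R N cs (f x) i
    = (\<Oplus>\<^bsub>R\<^esub>j\<in>{..<length bs}. coord R M bs x j \<otimes>\<^bsub>R\<^esub> coord R N cs (f (bs ! j)) i)"
proof -
  interpret M: based_module R M bs by fact
  interpret N: based_module R N cs by fact
  have fb: "f (bs ! j) \<in> carrier N" if "j < length bs" for j
    using that mod_hom_closed[OF assms(3)] M.basis_closed by blast
  have "coord R N cs (f x) i
      = coord R N cs (\<Oplus>\<^bsub>N\<^esub>j\<in>{..<length bs}. coord R M bs x j \<odot>\<^bsub>N\<^esub> f (bs ! j)) i"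
    using M.hom_expand[OF N.module_axioms assms(3,4)] by simp
  also have "\<dots> = (\<Oplus>\<^bsub>R\<^esub>j\<in>{..<length bs}. coord R N cs (coord R M bs x j \<odot>\<^bsub>N\<^esub> f (bs ! j)) i)"
    using assms(4,5) fb by (intro N.coord_finsum) (auto simp: M.coord_closed)
  also have "\<dots> = (\<Oplus>\<^bsub>R\<^esub>j\<in>{..<length bs}. coord R M bs x j \<otimes>\<^bsub>R\<^esub> coord R N cs (f (bs ! j)) i)"
    using assms(4,5) fb
    by (intro M.R.finsum_cong') (auto simp: M.coord_closed N.coord_closed N.coord_smult)
  finally show ?thesis .
qed

text \<open>The first diagonal entry of the identity \<open>w = f h' + h g\<close> on \<open>F\<close>.\<close>

lemma homotopy_scalar_mem:
  assumes "based_module R F bs" "based_module R G cs" "based_module R P ds" "ideal I R"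
    and "0 < length bs" "w \<in> carrier R"
    and f: "f \<in> mod_hom R P F" and g: "g \<in> mod_hom R F G"
    and h: "h \<in> mod_hom R G F" and h': "h' \<in> mod_hom R F P"
    and eq: "\<And>x. x \<in> carrier F \<Longrightarrow> w \<odot>\<^bsub>F\<^esub> x = f (h' x) \<oplus>\<^bsub>F\<^esub> h (g x)"
    and fI: "\<And>i j. i < length bs \<Longrightarrow> j < length ds \<Longrightarrow> coord R F bs (f (ds ! j)) i \<in> I"
    and gI: "\<And>i j. i < length cs \<Longrightarrow> j < length bs \<Longrightarrow> coord R G cs (g (bs ! j)) i \<in> I"
  shows "w \<in> I"
proof -
  interpret F: based_module R F bs by fact
  interpret G: based_module R G cs by fact
  interpret P: based_module R P ds by fact
  interpret I: ideal I R by fact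
  let ?e = "bs ! 0"
  have e: "?e \<in> carrier F" using assms(5) by (rule F.basis_closed)
  have h'e: "h' ?e \<in> carrier P" and ge: "g ?e \<in> carrier G"
    using e h' g mod_hom_closed by metis+
  have fh': "f (h' ?e) \<in> carrier F" and hg: "h (g ?e) \<in> carrier F"
    using h'e ge f h mod_hom_closed by metis+
  have hc: "h (cs ! j) \<in> carrier F" if "j < length cs" for j
    using that h G.basis_closed mod_hom_closed by metis
  \<comment> \<open>Here the entries of \<open>f\<close> are the factors in \<open>I\<close>; in the
    next claim they are the coordinates of \<open>g ?e\<close>, the first column of
    \<open>g\<close>.\<close>
  have "coord R F bs (f (h' ?e)) 0 \<in> I"
    unfolding coord_hom_expand[OF assms(3,1) f h'e assms(5)]
    using h'e assms(5)
    by (intro I.finsum_mult_mem(2)) (auto simp: P.coord_closed fI F.R.is_cring)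
  moreover have "coord R F bs (h (g ?e)) 0 \<in> I"
    unfolding coord_hom_expand[OF assms(2,1) h ge assms(5)]
    using assms(5) by (intro I.finsum_mult_mem(1)) (auto simp: F.coord_closed gI hc F.R.is_cring)
  moreover have "coord R F bs (w \<odot>\<^bsub>F\<^esub> ?e) 0 = w"
    using assms(5,6) e by (simp add: F.coord_smult F.coord_basis)
  ultimately show ?thesis
    using eq[OF e] F.coord_add[OF fh' hg assms(5)] I.a_closed by metis
qed

section \<open>Resolutions of bounded complexes\<close>

text \<open>Where \<open>M\<close> vanishes its homology has at most one class, so injectivity of
  the induced map leaves a single class for \<open>F\<close>. The coset of a cycle is then that of
  zero, which is the set of boundaries.\<close>

lemma exact_of_quasi_iso:
  assumes M: "chain_complex R M" and F: "chain_complex R F"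
    and qi: "quasi_iso R F M \<phi>" and i: "i \<notin> cplx_support M"
  shows "cycles F i = boundaries F i"
proof
  interpret M: chain_complex R M by fact
  interpret F: chain_complex R F by fact
  have dd: "diff F i (diff F (i + 1) x) = \<zero>\<^bsub>obj F (i - 1)\<^esub>" if "x \<in> carrier (obj F (i + 1))" for x
    using F.diff_diff[OF that] by simp
  have hom: "diff F (i + 1) \<in> mod_hom R (obj F (i + 1)) (obj F i)"
    using F.diff_hom[of "i + 1"] by simp
  show "boundaries F i \<subseteq> cycles F i"
    using dd mod_hom_closed[OF hom] by (auto simp: boundaries_def cycles_def)
  interpret Fi: module R "obj F i" by (rule F.obj_module)
  interpret Fi1: module R "obj F (i + 1)" by (rule F.obj_module)
  have zero_bound: "\<zero>\<^bsub>obj F i\<^esub> \<in> boundaries F i"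
    unfolding boundaries_def
    using mod_hom_zero[OF F.obj_module F.obj_module hom] by (metis Fi1.M.zero_closed imageI)
  let ?coset = "\<lambda>x. boundaries F i +>\<^bsub>obj F i\<^esub> x"
  have bc: "boundaries F i \<subseteq> carrier (obj F i)"
    using mod_hom_closed[OF hom] by (auto simp: boundaries_def)
  have carrier_F: "carrier (homology F i) = ?coset ` cycles F i"
    by (auto simp: homology_def FactGroup_def RCOSETS_def a_r_coset_def r_coset_def)
  have "cycles M i \<subseteq> {\<zero>\<^bsub>obj M i\<^esub>}"
    using i by (auto simp: cplx_support_def cycles_def)
  then have "carrier (homology M i) \<subseteq> {boundaries M i +>\<^bsub>obj M i\<^esub> \<zero>\<^bsub>obj M i\<^esub>}"
    by (auto simp: homology_def FactGroup_def RCOSETS_def a_r_coset_def r_coset_def)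
  moreover have inj: "inj_on (homology_map M \<phi> i) (carrier (homology F i))"
    and "homology_map M \<phi> i ` carrier (homology F i) = carrier (homology M i)"
    using qi by (auto simp: quasi_iso_def iso_def bij_betw_def)
  ultimately have const: "homology_map M \<phi> i C = boundaries M i +>\<^bsub>obj M i\<^esub> \<zero>\<^bsub>obj M i\<^esub>"
    if "C \<in> carrier (homology F i)" for C
    using that by (metis (no_types) imageI singletonD subsetD)
  have eq: "C = D" if "C \<in> carrier (homology F i)" "D \<in> carrier (homology F i)" for C D
    by (rule inj_onD[OF inj _ that]) (simp only: const that)
  show "cycles F i \<subseteq> boundaries F i"
  proof
    fix x assume x: "x \<in> cycles F i"
    then have xc: "x \<in> carrier (obj F i)" by (simp add: cycles_def)
    have "\<zero>\<^bsub>obj F i\<^esub> \<in> cycles F i"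
      unfolding cycles_def using mod_hom_zero[OF F.obj_module F.obj_module F.diff_hom] by simp
    with x have "?coset x = ?coset \<zero>\<^bsub>obj F i\<^esub>"
      by (intro eq) (auto simp: carrier_F)
    moreover have "x \<in> ?coset x"
      using zero_bound xc by (force simp: a_r_coset_def r_coset_def)
    moreover have "?coset \<zero>\<^bsub>obj F i\<^esub> = boundaries F i"
    proof -
      have "y \<oplus>\<^bsub>obj F i\<^esub> \<zero>\<^bsub>obj F i\<^esub> = y" if "y \<in> boundaries F i" for y
        using bc that by (simp add: subset_iff)
      then show ?thesis by (simp add: a_r_coset_def r_coset_def)
    qed
    ultimately show "x \<in> boundaries F i" by simp
  qed
qed

text \<open>If \<open>w d = d h d\<close> in degree \<open>j\<close>, then \<open>w - h d\<close>
  takes values in cycles, which are boundaries by exactness, and freeness lifts it through the next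
  differential to \<open>h'\<close>.\<close>

lemma (in chain_complex) scaled_homotopy:
  assumes basis: "\<And>i. based_module R (obj M i) (bs i)"
    and exact: "\<And>i. i \<ge> k \<Longrightarrow> cycles M i = boundaries M i"
    and w: "w \<in> carrier R"
    and start: "h0 \<in> mod_hom R (obj M (k - 1)) (obj M k)"
      "\<And>x. x \<in> carrier (obj M k)
        \<Longrightarrow> w \<odot>\<^bsub>obj M (k - 1)\<^esub> diff M k x = diff M k (h0 (diff M k x))"
    and "k \<le> j"
  obtains h h' where
    "h \<in> mod_hom R (obj M (j - 1)) (obj M j)" "h' \<in> mod_hom R (obj M j) (obj M (j + 1))"
    "\<And>x. x \<in> carrier (obj M j)
      \<Longrightarrow> w \<odot>\<^bsub>obj M j\<^esub> x = diff M (j + 1) (h' x) \<oplus>\<^bsub>obj M j\<^esub> h (diff M j x)"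
proof -
  \<comment> \<open>The induction invariant: the \<open>h'\<close> produced in degree
    \<open>j\<close> becomes the \<open>h\<close> of degree \<open>j + 1\<close>.\<close>
  define Q where "Q j h \<longleftrightarrow> h \<in> mod_hom R (obj M (j - 1)) (obj M j) \<and>
    (\<forall>x\<in>carrier (obj M j). w \<odot>\<^bsub>obj M (j - 1)\<^esub> diff M j x = diff M j (h (diff M j x)))"
    for j h
  have d': "diff M (j + 1) \<in> mod_hom R (obj M (j + 1)) (obj M j)" for j
    using diff_hom[of "j + 1"] by simp
  have Q_step: "\<exists>h'\<in>mod_hom R (obj M j) (obj M (j + 1)).
      (\<forall>x\<in>carrier (obj M j). w \<odot>\<^bsub>obj M j\<^esub> x = diff M (j + 1) (h' x) \<oplus>\<^bsub>obj M j\<^esub> h (diff M j x))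
      \<and> Q (j + 1) h'"
    if j: "j \<ge> k" and Q: "Q j h" for j h
  proof -
    interpret Mj: based_module R "obj M j" "bs j" by (rule basis)
    interpret Mj': module R "obj M (j - 1)" by (rule obj_module)
    have h: "h \<in> mod_hom R (obj M (j - 1)) (obj M j)"
      and hd: "\<And>x. x \<in> carrier (obj M j)
        \<Longrightarrow> w \<odot>\<^bsub>obj M (j - 1)\<^esub> diff M j x = diff M j (h (diff M j x))"
      using Q by (auto simp: Q_def)
    note dc = mod_hom_closed[OF diff_hom[of j]] and hc = mod_hom_closed[OF h]
    let ?f = "\<lambda>x. w \<odot>\<^bsub>obj M j\<^esub> x \<ominus>\<^bsub>obj M j\<^esub> h (diff M j x)"
    have f: "?f \<in> mod_hom R (obj M j) (obj M j)"
      by (intro mod_hom_minus_map[OF obj_module] mod_hom_smult_map[OF obj_module mod_hom_id w]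
          mod_hom_comp[OF diff_hom h])
    have img: "?f x \<in> diff M (j + 1) ` carrier (obj M (j + 1))" if x: "x \<in> carrier (obj M j)" for x
    proof -
      have "diff M j (?f x) = w \<odot>\<^bsub>obj M (j - 1)\<^esub> diff M j x \<ominus>\<^bsub>obj M (j - 1)\<^esub> diff M j (h (diff M j x))"
        using x w dc hc
        by (simp add: mod_hom_minus[OF obj_module obj_module diff_hom] mod_hom_smult[OF diff_hom])
      also have "\<dots> = \<zero>\<^bsub>obj M (j - 1)\<^esub>"
        using hd[OF x] dc[OF hc[OF dc[OF x]]] by (simp add: Mj'.M.minus_eq Mj'.M.r_neg)
      finally have "?f x \<in> cycles M j"
        using mod_hom_closed[OF f x] by (simp add: cycles_def)
      then show ?thesis using exact[OF j] by (simp add: boundaries_def)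
    qed
    obtain h' where h': "h' \<in> mod_hom R (obj M j) (obj M (j + 1))"
      and dh': "\<And>x. x \<in> carrier (obj M j) \<Longrightarrow> diff M (j + 1) (h' x) = ?f x"
      using Mj.hom_lift[OF obj_module obj_module f d' img] by blast
    have "w \<odot>\<^bsub>obj M j\<^esub> x = diff M (j + 1) (h' x) \<oplus>\<^bsub>obj M j\<^esub> h (diff M j x)"
      if x: "x \<in> carrier (obj M j)" for x
      using x w dc hc by (simp add: dh' Mj.M.minus_eq Mj.M.a_assoc Mj.M.l_neg)
    \<comment> \<open>On a boundary the term \<open>h d\<close> vanishes because
      \<open>d d = 0\<close>, so the lifting identity reads \<open>w d = d h' d\<close> one degree
      higher.\<close>
    moreover have "Q (j + 1) h'"
    proof -
      have "w \<odot>\<^bsub>obj M j\<^esub> diff M (j + 1) y = diff M (j + 1) (h' (diff M (j + 1) y))"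
        if y: "y \<in> carrier (obj M (j + 1))" for y
      proof -
        have yc: "diff M (j + 1) y \<in> carrier (obj M j)" using mod_hom_closed[OF d' y] .
        have "diff M j (diff M (j + 1) y) = \<zero>\<^bsub>obj M (j - 1)\<^esub>" using diff_diff[OF y] by simp
        then have "?f (diff M (j + 1) y) = w \<odot>\<^bsub>obj M j\<^esub> diff M (j + 1) y"
          using yc w mod_hom_zero[OF obj_module obj_module h] by (simp add: Mj.M.minus_eq)
        with dh'[OF yc] show ?thesis by simp
      qed
      with h' show ?thesis by (simp add: Q_def)
    qed
    ultimately show ?thesis using h' by blast
  qed
  \<comment> \<open>The induction only yields \<open>h\<close>; one more use of
    \<open>Q_step\<close> in degree \<open>j\<close> adds \<open>h'\<close> and the homotopy
    identity.\<close>
  have "\<exists>h. Q j h"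
    using \<open>k \<le> j\<close>
  proof (induction j rule: int_ge_induct)
    case base
    then show ?case using start by (auto simp: Q_def)
  next
    case (step j)
    then show ?case using Q_step by meson
  qed
  then obtain h where "Q j h" ..
  with Q_step[OF \<open>k \<le> j\<close> this] that show ?thesis by (auto simp: Q_def)
qed

text \<open>With both modules nonzero, \<open>minors_ideal\<close> is generated by minors, and those
  of size 1 are the matrix entries.\<close>

lemma (in cring) diff_entry_mem:
  assumes F: "chain_complex R F" and free: "\<And>i. based_module R (obj F i) (some_basis R (obj F i))"
    and nz: "carrier (obj F i) \<noteq> {\<zero>\<^bsub>obj F i\<^esub>}" "carrier (obj F (i - 1)) \<noteq> {\<zero>\<^bsub>obj F (i - 1)\<^esub>}"
    and k: "k < length (some_basis R (obj F (i - 1)))" and j: "j < length (some_basis R (obj F i))"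
  shows "coord R (obj F (i - 1)) (some_basis R (obj F (i - 1)))
    (diff F i (some_basis R (obj F i) ! j)) k \<in> minors_ideal_at R F 1 i"
proof -
  interpret F: chain_complex R F by fact
  interpret A: based_module R "obj F i" "some_basis R (obj F i)" by (rule free)
  interpret B: based_module R "obj F (i - 1)" "some_basis R (obj F (i - 1))" by (rule free)
  let ?n = "length (some_basis R (obj F i))" and ?p = "length (some_basis R (obj F (i - 1)))"
  let ?A = "matrix_of R (obj F (i - 1)) (some_basis R (obj F i)) (some_basis R (obj F (i - 1)))
    (diff F i)"
  have closed: "?A k j \<in> carrier R"
    unfolding matrix_of_def
    by (rule B.coord_closed[OF mod_hom_closed[OF F.diff_hom A.basis_closed[OF j]] k])
  have "?A k j \<in> minors R ?p ?n ?A 1"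
    by (rule entry_in_minors[of k ?p j ?n ?A, OF k j closed])
  then have "?A k j \<in> Idl (minors R ?p ?n ?A 1)"
    by (auto simp: genideal_def)
  with nz show ?thesis by (simp add: minors_ideal_at_def minors_ideal_def matrix_of_def)
qed

theorem theorem2p8:
  fixes R :: "('a, 'r) ring_scheme" and m :: "'a set"
    and M :: "('a, 'b) cplx" and F :: "('a, 'c) cplx"
  assumes "local_ring R m"
    and "chain_complex R M" and "bounded_cplx M" and "\<And>i. fin_gen R (obj M i)"
    and "minimal_free_resolution R m F M"
  shows "stable_ideal R F 1 \<noteq> {\<zero>\<^bsub>R\<^esub>}"
proof -
  interpret L: local_ring R m by fact
  interpret m: maximalideal m R by (rule L.max_ideal)
  have one: "\<one>\<^bsub>R\<^esub> \<noteq> \<zero>\<^bsub>R\<^esub>"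
  proof
    assume "\<one>\<^bsub>R\<^esub> = \<zero>\<^bsub>R\<^esub>"
    then have "\<one>\<^bsub>R\<^esub> \<in> m" using m.zero_closed by simp
    then show False using m.one_imp_carrier m.I_notcarr by simp
  qed
  obtain s where s: "s \<in> carrier R" "s \<noteq> \<zero>\<^bsub>R\<^esub>" and
    prime: "\<And>a b. a \<in> carrier R \<Longrightarrow> b \<in> carrier R \<Longrightarrow> s \<otimes>\<^bsub>R\<^esub> a \<noteq> \<zero>\<^bsub>R\<^esub> \<Longrightarrow> s \<otimes>\<^bsub>R\<^esub> b \<noteq> \<zero>\<^bsub>R\<^esub>
      \<Longrightarrow> s \<otimes>\<^bsub>R\<^esub> (a \<otimes>\<^bsub>R\<^esub> b) \<noteq> \<zero>\<^bsub>R\<^esub>"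
    using L.exists_prime_annihilator[OF L.noetherian_ring_axioms one] by blast
  from assms(5) obtain \<phi> where F: "chain_complex R F" and free: "\<And>i. fin_free R (obj F i)"
    and qi: "quasi_iso R F M \<phi>"
    by (auto simp: minimal_free_resolution_def)
  interpret F: chain_complex R F by fact
  let ?b = "\<lambda>i. some_basis R (obj F i)"
  \<comment> \<open>These are the bases used in \<open>minors_ideal\<close>, so the coordinates
    below are the very entries that generate the ideals.\<close>
  have basis: "based_module R (obj F i) (?b i)" for i
    using F.obj_module someI_ex[OF free[of i, unfolded fin_free_def]]
    by (simp add: based_module_def based_module_axioms_def some_basis_def)
  obtain k0 where k0: "\<And>i. i \<in> cplx_support M \<Longrightarrow> i \<le> k0"
    using assms(3) by (auto simp: bounded_cplx_def bdd_above_def)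
  \<comment> \<open>One degree above a bound for the support of \<open>M\<close>; \<open>F\<close>
    is exact from here on.\<close>
  define k where "k = k0 + 1"
  have exact: "cycles F i = boundaries F i" if "i \<ge> k" for i
    using exact_of_quasi_iso[OF assms(2) F qi] k0[of i] that by (auto simp: k_def)
  obtain u h where u: "u \<in> carrier R" "s \<otimes>\<^bsub>R\<^esub> u \<noteq> \<zero>\<^bsub>R\<^esub>"
    and h: "h \<in> mod_hom R (obj F (k - 1)) (obj F k)"
    and uh: "\<And>x. x \<in> carrier (obj F k) \<Longrightarrow> (s \<otimes>\<^bsub>R\<^esub> u) \<odot>\<^bsub>obj F (k - 1)\<^esub> diff F k x
      = s \<odot>\<^bsub>obj F (k - 1)\<^esub> diff F k (h (diff F k x))"
    using scaled_inverse[OF basis basis F.diff_hom s prime] by blast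
  define w where "w = s \<otimes>\<^bsub>R\<^esub> u"
  have w: "w \<in> carrier R" "w \<noteq> \<zero>\<^bsub>R\<^esub>" using s u by (auto simp: w_def)
  \<comment> \<open>The factor \<open>s\<close> is absorbed into the map, giving
    \<open>w d = d h0 d\<close>, the start of the homotopy.\<close>
  define h0 where "h0 y = s \<odot>\<^bsub>obj F k\<^esub> h y" for y
  have h0: "h0 \<in> mod_hom R (obj F (k - 1)) (obj F k)"
    unfolding h0_def by (rule mod_hom_smult_map[OF F.obj_module h s(1)])
  have h0d: "w \<odot>\<^bsub>obj F (k - 1)\<^esub> diff F k x = diff F k (h0 (diff F k x))"
    if x: "x \<in> carrier (obj F k)" for x
    using uh[OF x] mod_hom_smult[OF F.diff_hom _ s(1)]
      mod_hom_closed[OF h mod_hom_closed[OF F.diff_hom x]]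
    by (simp add: w_def h0_def)
  \<comment> \<open>The element \<open>w\<close> was fixed before \<open>n\<close>, so a single
    nonzero element lies in every tail ideal. \<open>J\<close> ranges over the ideals whose
    intersection is the generated one.\<close>
  have "w \<in> J" if J: "ideal J R" "(\<Union>i\<in>{n<..}. minors_ideal_at R F 1 i) \<subseteq> J" for J n
  proof -
    \<comment> \<open>Both \<open>j\<close> and \<open>j + 1\<close> exceed \<open>n\<close>, so the
      ideals of both differentials at \<open>F\<close> in degree \<open>j\<close> belong to the
      tail.\<close>
    define j where "j = max n k + 1"
    have j: "k \<le> j" and mem: "minors_ideal_at R F 1 j \<subseteq> J" "minors_ideal_at R F 1 (j + 1) \<subseteq> J"
      using J(2) by (auto simp: j_def UN_subset_iff)
    show ?thesis
    proof (cases "\<exists>i\<in>{j - 1, j, j + 1}. carrier (obj F i) = {\<zero>\<^bsub>obj F i\<^esub>}")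
      case True
      \<comment> \<open>A zero module at \<open>j - 1\<close> or \<open>j\<close> makes the ideal at
        \<open>j\<close> the unit ideal; one at \<open>j + 1\<close> does so for the ideal at
        \<open>j + 1\<close>.\<close>
      then have "carrier R \<subseteq> J"
        using mem by (auto simp: minors_ideal_at_def minors_ideal_def split: if_splits)
      with w show ?thesis by blast
    next
      case False
      then have nz: "carrier (obj F (j - 1)) \<noteq> {\<zero>\<^bsub>obj F (j - 1)\<^esub>}"
        "carrier (obj F j) \<noteq> {\<zero>\<^bsub>obj F j\<^esub>}" "carrier (obj F (j + 1)) \<noteq> {\<zero>\<^bsub>obj F (j + 1)\<^esub>}"
        by auto
      obtain g g' where g: "g \<in> mod_hom R (obj F (j - 1)) (obj F j)"
        "g' \<in> mod_hom R (obj F j) (obj F (j + 1))"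
        and hty: "\<And>x. x \<in> carrier (obj F j) \<Longrightarrow>
          w \<odot>\<^bsub>obj F j\<^esub> x = diff F (j + 1) (g' x) \<oplus>\<^bsub>obj F j\<^esub> g (diff F j x)"
        using F.scaled_homotopy[OF basis exact w(1) h0 h0d j] by blast
      have d: "diff F (j + 1) \<in> mod_hom R (obj F (j + 1)) (obj F j)"
        using F.diff_hom[of "j + 1"] by simp
      have in1: "coord R (obj F j) (?b j) (diff F (j + 1) (?b (j + 1) ! l)) i \<in> J"
        if "i < length (?b j)" "l < length (?b (j + 1))" for i l
        using L.diff_entry_mem[OF F basis, of "j + 1" i l] nz that mem(2) by auto
      have in2: "coord R (obj F (j - 1)) (?b (j - 1)) (diff F j (?b j ! l)) i \<in> J"
        if "i < length (?b (j - 1))" "l < length (?b j)" for i l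
        using L.diff_entry_mem[OF F basis, of j i l] nz that mem(1) by auto
      show ?thesis
        by (rule homotopy_scalar_mem[OF basis basis basis J(1)
            based_module.length_pos[OF basis nz(2)] w(1) d F.diff_hom g hty in1 in2])
    qed
  qed
  then have "w \<in> stable_ideal R F 1"
    by (auto simp: stable_ideal_def genideal_def)
  with w show ?thesis by blast
qed

end
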